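(* Let $k,j\ge 0$ and $m\ge 1$ be integers and put $n=2m+kj$ (so $n\ge 1$). Then, as polynomials in the indeterminates $t_1,t_2,\dots$, $$\sum_{P\in\mathfrak{P}_{n,k}^{m,j}}\prod_{i\geq1}t_i^{\beta_i(P)}=\sum_{p=0}^{m}\left\{\frac{m-p}{m+j}\binom{m+j}{j}+\frac{m-p+1}{m+j}\binom{m+j}{j-1}\right\}\frac{\mathbf{P}_{p}^{(m+j)}\big(1!\,t_1,2!\,t_2,\dots\big)}{p!}$$ $$=\binom{m+j}{j}\sum_{p=0}^{m}\frac{(m+1)(m-p)+j(m-p+1)}{(m+1)(m+j)}\sum_{r=0}^{p}\binom{m+j}{r}\frac{r!}{p!}\,\mathbf{B}_{p,r}\big(1!\,t_1,2!\,t_2,\dots\big).$$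
   Context: Fix an integer $k\ge 0$. Lattice paths use the steps $u=(1,1)$ (up-step), $d=(1,-1)$ (down-step), $h=(k,0)$ (horizontal-step), and a path is regarded as the sequence (word in the letters $u,d,h$) of its steps; for $k=0$ the letter $h$ is a formal letter not changing the position. A $k$-path of length $n$ is such a path from $(0,0)$ to $(n,0)$ that never goes below the $x$-axis. $\mathfrak{P}_{n,k}^{m,j}$ is the set of $k$-paths with exactly $m$ up-steps and $j$ horizontal-steps (hence $m$ down-steps and $n=2m+kj$). A $u$-segment of a path is a maximal sequence of consecutive up-steps. An internal $u$-segment is a $u$-segment lying between two steps each of which is $d$ or $h$; that is, every $u$-segment except one with which the path begins (a $u$-segment preceded by an $h$ is internal, even if it is the leftmost one). $\beta_i(P)$ is the number of internal $u$-segments of length $i$ in $P$. $\mathbf{B}_{p,r}(x_1,x_2,\dots)$ is the partial Bell polynomial $\sum \frac{p!}{r_1!r_2!\cdots r_p!}\left(\frac{x_1}{1!}\right)^{r_1}\cdots\left(\frac{x_p}{p!}\right)^{r_p}$, the sum being over nonnegative integers with $r_1+\cdots+r_p=r$ and $r_1+2r_2+\cdots+pr_p=p$ (so $\mathbf{B}_{0,0}=1$, $\mathbf{B}_{p,0}=0$ for $p\ge1$). The potential polynomials $\mathbf{P}_p^{(\lambda)}=\mathbf{P}_p^{(\lambda)}(f_1,f_2,\dots)$ are defined by $\mathbf{P}_0^{(\lambda)}=1$ and $1+\sum_{p\ge1}\mathbf{P}_p^{(\lambda)}\frac{x^p}{p!}=\Big(1+\sum_{p\ge1}f_p\frac{x^p}{p!}\Big)^{\lambda}$.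 Convention: $\binom{a}{-1}=0$. *)

theory Defs
  imports
    "HOL-Library.Poly_Mapping"
    "HOL-Library.Product_Plus"
    "HOL-Computational_Algebra.Formal_Power_Series"
begin

section \<open>Lattice paths\<close>

datatype step = U | D | H

primrec step_vec :: "nat \<Rightarrow> step \<Rightarrow> int \<times> int" where
  "step_vec k U = (1, 1)"
| "step_vec k D = (1, -1)"
| "step_vec k H = (int k, 0)"

definition endpoint :: "nat \<Rightarrow> step list \<Rightarrow> int \<times> int" where
  "endpoint k P = sum_list (map (step_vec k) P)"

text \<open>Paths are words in the letters, so for \<open>k = 0\<close> the letter \<open>H\<close> still counts
  although it does not move. Every step is a straight segment (or a point), so it suffices to
  require the vertices, i.e. the endpoints of all prefixes, to be on or above the axis.\<close>

definition is_kpath :: "nat \<Rightarrow> nat \<Rightarrow> step list \<Rightarrow> bool" where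
  "is_kpath k n P \<longleftrightarrow>
     endpoint k P = (int n, 0) \<and> (\<forall>l \<le> length P. 0 \<le> snd (endpoint k (take l P)))"

definition kpaths :: "nat \<Rightarrow> nat \<Rightarrow> nat \<Rightarrow> nat \<Rightarrow> step list set" where
  "kpaths n k m j = {P. is_kpath k n P \<and> count_list P U = m \<and> count_list P H = j}"

text \<open>The steps of \<open>P\<close> at the (0-based) positions \<open>a, \<dots>, a + i - 1\<close> form a maximal
  nonempty block of consecutive up-steps.\<close>

definition u_segment :: "step list \<Rightarrow> nat \<Rightarrow> nat \<Rightarrow> bool" where
  "u_segment P a i \<longleftrightarrow>
     1 \<le> i \<and> a + i \<le> length P \<and> (\<forall>l. a \<le> l \<and> l < a + i \<longrightarrow> P ! l = U) \<and>
     (0 < a \<longrightarrow> P ! (a - 1) \<noteq> U) \<and> (a + i < length P \<longrightarrow> P ! (a + i) \<noteq> U)"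

text \<open>By maximality, the two neighbouring steps, whose existence is required here, are
  automatically \<open>D\<close> or \<open>H\<close>.\<close>

definition internal_u_segment :: "step list \<Rightarrow> nat \<Rightarrow> nat \<Rightarrow> bool" where
  "internal_u_segment P a i \<longleftrightarrow> u_segment P a i \<and> 0 < a \<and> a + i < length P"

definition beta :: "nat \<Rightarrow> step list \<Rightarrow> nat" where
  "beta i P = card {a. internal_u_segment P a i}"

section \<open>Polynomials over the rationals in indeterminates indexed by \<open>nat\<close>\<close>

text \<open>A polynomial is a finitely supported family of coefficients indexed by monomials, and a
  monomial is a finitely supported family of exponents; multiplication is convolution.\<close>

type_synonym qpoly = "(nat \<Rightarrow>\<^sub>0 nat) \<Rightarrow>\<^sub>0 rat"

definition Cst :: "rat \<Rightarrow> qpoly" where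
  "Cst c = Poly_Mapping.single 0 c"

definition Var :: "nat \<Rightarrow> qpoly" where
  "Var i = Poly_Mapping.single (Poly_Mapping.single i 1) 1"

text \<open>The product over all \<open>i \<ge> 1\<close>; no segment is longer than the path itself, so all factors
  beyond the bound are \<open>1\<close>.\<close>

definition path_weight :: "step list \<Rightarrow> qpoly" where
  "path_weight P = (\<Prod>i = 1..length P. Var i ^ beta i P)"

section \<open>Bell polynomials and potential polynomials\<close>

definition bell_indices :: "nat \<Rightarrow> nat \<Rightarrow> (nat \<Rightarrow> nat) set" where
  "bell_indices p r = {s. (\<forall>i. i \<notin> {1..p} \<longrightarrow> s i = 0) \<and>
     (\<Sum>i = 1..p. s i) = r \<and> (\<Sum>i = 1..p. i * s i) = p}"

definition bell :: "nat \<Rightarrow> nat \<Rightarrow> (nat \<Rightarrow> qpoly) \<Rightarrow> qpoly" where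
  "bell p r x = (\<Sum>s \<in> bell_indices p r.
     Cst (fact p / (\<Prod>i = 1..p. fact (s i))) * (\<Prod>i = 1..p. (Cst (1 / fact i) * x i) ^ s i))"

text \<open>Only exponents \<open>\<lambda>\<close> that are natural numbers are considered, so the power of the
  exponential generating function is an ordinary one.\<close>

definition egf :: "(nat \<Rightarrow> qpoly) \<Rightarrow> qpoly fps" where
  "egf f = Abs_fps (\<lambda>p. if p = 0 then 1 else Cst (1 / fact p) * f p)"

definition potential :: "nat \<Rightarrow> nat \<Rightarrow> (nat \<Rightarrow> qpoly) \<Rightarrow> qpoly" where
  "potential l p f = Cst (fact p) * fps_nth (egf f ^ l) p"

text \<open>Binomial coefficients with the convention that a negative lower index gives \<open>0\<close>.\<close>

definition binom :: "nat \<Rightarrow> int \<Rightarrow> rat" where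
  "binom a b = (if b < 0 then 0 else of_nat (a choose nat b))"

end

theory Submission
  imports Defs
begin

text \<open>A path is an initial run of up-steps followed by \<open>N = m + j\<close> blocks, each consisting of a
  down- or horizontal step and the run of up-steps after it. Seen from its endpoint, the path is
  nonnegative iff in every suffix starting at a block the up-steps are outnumbered, weakly, by the
  down-steps of the later blocks. Let \<open>g\<close> be the generating function of a run of up-steps. Stripping
  the first block gives a recursion in \<open>N\<close> for the weight of the block sequences with \<open>m\<close> down-steps
  and \<open>p\<close> up-steps. Since \<open>(N + 1) g (g^N)' = N (g^(N+1))'\<close>, factors linear in \<open>p\<close> pass through the
  recursion, and by induction this weight is \<open>C(N, m) - p C(N+1, m+1) / N\<close> times the coefficient
  of \<open>x^p\<close> in \<open>g^N\<close>.
  The potential polynomials expand into Bell polynomials by the binomial theorem for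
  \<open>(1 + (g - 1))^N\<close>, where powers of \<open>g - 1\<close> are handled by raising one exponent at a time.\<close>

section \<open>Constants and generating functions\<close>

lemma Cst_0 [simp]: "Cst 0 = 0"
  by (simp add: Cst_def)

lemma Cst_1 [simp]: "Cst 1 = 1"
  by (simp add: Cst_def)

lemma Cst_add: "Cst (a + b) = Cst a + Cst b"
  by (simp add: Cst_def single_add)

lemma Cst_diff: "Cst (a - b) = Cst a - Cst b"
  by (simp add: Cst_def single_diff)

lemma Cst_mult: "Cst (a * b) = Cst a * Cst b"
  by (simp add: Cst_def mult_single)

lemma Cst_mult_assoc: "Cst a * (Cst b * x) = Cst (a * b) * x"
  by (simp add: Cst_mult mult.assoc)

lemma Cst_of_nat: "Cst (of_nat n) = of_nat n"
  by (induction n) (simp_all add: Cst_add)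

lemma Cst_prod: "Cst (\<Prod>i\<in>A. f i) = (\<Prod>i\<in>A. Cst (f i))"
  by (induction A rule: infinite_finite_induct) (simp_all add: Cst_mult)

text \<open>An empty run is not a \<open>u\<close>-segment, so it weighs 1 rather than
  \<open>Var 0\<close>.\<close>

definition seg_weight :: "nat \<Rightarrow> qpoly" where
  "seg_weight a = (if a = 0 then 1 else Var a)"

definition seg_gf :: "qpoly fps" where
  "seg_gf = Abs_fps seg_weight"

lemma seg_gf_eq_egf: "egf (\<lambda>i. Cst (fact i) * Var i) = seg_gf"
  by (rule fps_ext) (simp add: egf_def seg_gf_def seg_weight_def Cst_mult_assoc)

section \<open>Convolution identities for powers of the run generating function\<close>

lemma seg_gf_power_Suc:
  "fps_nth (seg_gf ^ Suc N) p = (\<Sum>a = 0..p. seg_weight a * fps_nth (seg_gf ^ N) (p - a))"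
  by (simp add: fps_mult_nth seg_gf_def)

text \<open>The operator x d/dx multiplies the coefficient of x^q by q, so this compares
  coefficients in (N+1) f * x (f^N)' = N * x (f^(N+1))'; both sides are N (N+1) x f' f^N.\<close>

lemma fps_power_weighted_convolution:
  fixes f :: "'a :: comm_ring_1 fps"
  shows "of_nat (Suc N) * (\<Sum>a = 0..p. fps_nth f a * (of_nat (p - a) * fps_nth (f ^ N) (p - a)))
    = of_nat N * (of_nat p * fps_nth (f ^ Suc N) p)"
proof -
  have nth: "fps_nth (fps_X * fps_deriv g) q = of_nat q * fps_nth g q" for g :: "'a fps" and q
    by (cases q) (simp_all add: fps_deriv_nth)
  have "of_nat (Suc N) * (f * (fps_X * fps_deriv (f ^ N)))
      = of_nat N * (fps_X * fps_deriv (f ^ Suc N))"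
  proof (cases N)
    case (Suc n)
    have deriv: "fps_deriv (f ^ Suc l) = of_nat (Suc l) * (fps_deriv f * f ^ l)" for l
      by (simp add: fps_deriv_power fps_of_nat mult.assoc del: of_nat_Suc power_Suc)
    show ?thesis
      unfolding Suc deriv by (simp only: power_Suc mult_ac)
  qed simp
  from arg_cong[OF this, of "\<lambda>g. fps_nth g p"] show ?thesis
    by (simp only: fps_mult_of_nat_nth fps_mult_nth[of f] nth)
qed

text \<open>Convolution treats the constant A as a plain factor and scales the linear part by N /
  (N+1), turning B / N into B / (N+1). For N = 0 the linear part on the left is 0, a division by
  zero; the hypothesis makes it vanish on the right as well.\<close>

lemma seg_gf_linear_convolution:
  assumes "N = 0 \<Longrightarrow> of_nat p * B = 0"
  shows "(\<Sum>a = 0..p. seg_weight a *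
      (Cst (A - of_nat (p - a) * B / of_nat N) * fps_nth (seg_gf ^ N) (p - a)))
    = Cst (A - of_nat p * B / of_nat (Suc N)) * fps_nth (seg_gf ^ Suc N) p"
proof (cases "N = 0")
  case True
  then have "A - of_nat p * B / of_nat (Suc N) = A"
    using assms by auto
  then show ?thesis
    by (simp only: seg_gf_power_Suc sum_distrib_left) (simp add: True mult.left_commute)
next
  case False
  let ?S = "\<Sum>a = 0..p. seg_weight a * (of_nat (p - a) * fps_nth (seg_gf ^ N) (p - a))"
  have "(\<Sum>a = 0..p. seg_weight a *
      (Cst (A - of_nat (p - a) * B / of_nat N) * fps_nth (seg_gf ^ N) (p - a)))
    = (\<Sum>a = 0..p. Cst A * (seg_weight a * fps_nth (seg_gf ^ N) (p - a))
        - Cst (B / of_nat N) * (seg_weight a * (of_nat (p - a) * fps_nth (seg_gf ^ N) (p - a))))"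
  proof (rule sum.cong[OF refl])
    fix a
    have "of_nat (p - a) * B / of_nat N = B / of_nat N * of_nat (p - a)"
      by simp
    then show "seg_weight a *
      (Cst (A - of_nat (p - a) * B / of_nat N) * fps_nth (seg_gf ^ N) (p - a))
      = Cst A * (seg_weight a * fps_nth (seg_gf ^ N) (p - a))
        - Cst (B / of_nat N) * (seg_weight a * (of_nat (p - a) * fps_nth (seg_gf ^ N) (p - a)))"
      by (simp only: Cst_diff Cst_mult Cst_of_nat) (simp add: algebra_simps)
  qed
  also have "\<dots> = Cst A * fps_nth (seg_gf ^ Suc N) p - Cst (B / of_nat N) * ?S"
    by (simp add: sum_subtractf sum_distrib_left seg_gf_power_Suc del: power_Suc)
  \<comment> \<open>A factor N + 1 is split off so that the weighted convolution identity
    applies.\<close>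
  also have "Cst (B / of_nat N) * ?S
      = Cst (B / (of_nat N * of_nat (Suc N))) * (of_nat (Suc N) * ?S)"
    by (simp add: Cst_of_nat[symmetric] Cst_mult_assoc del: of_nat_Suc)
  also have "of_nat (Suc N) * ?S = of_nat N * (of_nat p * fps_nth (seg_gf ^ Suc N) p)"
    using fps_power_weighted_convolution[of N seg_gf p] by (simp add: seg_gf_def)
  also have "Cst (B / (of_nat N * of_nat (Suc N))) * \<dots>
      = Cst (of_nat p * B / of_nat (Suc N)) * fps_nth (seg_gf ^ Suc N) p"
    using False by (simp add: Cst_of_nat[symmetric] Cst_mult_assoc mult.commute del: of_nat_Suc)
  finally show ?thesis
    by (simp add: Cst_diff left_diff_distrib)
qed

section \<open>Encoding paths as lists of blocks\<close>

text \<open>A block \<open>(b, a)\<close> stands for a down-step (\<open>b = True\<close>) or a horizontal step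
  (\<open>b = False\<close>) followed by \<open>a\<close> up-steps.\<close>

fun word :: "(bool \<times> nat) list \<Rightarrow> step list" where
  "word [] = []"
| "word ((b, a) # xs) = (if b then D else H) # replicate a U @ word xs"

text \<open>Inverts \<open>word\<close>. The first component is the run at the front, not yet part
  of a block; a down- or horizontal step before it closes it into one.\<close>

fun blocks :: "step list \<Rightarrow> nat \<times> (bool \<times> nat) list" where
  "blocks [] = (0, [])"
| "blocks (U # P) = (Suc (fst (blocks P)), snd (blocks P))"
| "blocks (D # P) = (0, (True, fst (blocks P)) # snd (blocks P))"
| "blocks (H # P) = (0, (False, fst (blocks P)) # snd (blocks P))"

lemma blocks_replicate: "blocks (replicate a U @ P) = (a + fst (blocks P), snd (blocks P))"
  by (induction a) simp_all

lemma blocks_word: "blocks (word xs) = (0, xs)"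
  by (induction xs rule: word.induct) (simp_all add: blocks_replicate)

lemma word_blocks: "replicate (fst (blocks P)) U @ word (snd (blocks P)) = P"
  by (induction P rule: blocks.induct) simp_all

definition ups :: "(bool \<times> nat) list \<Rightarrow> nat" where
  "ups xs = sum_list (map snd xs)"

definition downs :: "(bool \<times> nat) list \<Rightarrow> nat" where
  "downs xs = length (filter fst xs)"

lemma ups_simps [simp]: "ups [] = 0" "ups ((b, a) # xs) = a + ups xs"
  by (simp_all add: ups_def)

lemma downs_simps [simp]: "downs [] = 0" "downs ((b, a) # xs) = of_bool b + downs xs"
  by (simp_all add: downs_def)

text \<open>Read backwards from its endpoint on the axis, a path has height \<open>downs - ups\<close>, and its
  local minima are the points following a down- or horizontal step.\<close>

fun dominated :: "(bool \<times> nat) list \<Rightarrow> bool" where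
  "dominated [] \<longleftrightarrow> True"
| "dominated ((b, a) # xs) \<longleftrightarrow> a + ups xs \<le> downs xs \<and> dominated xs"

section \<open>Step counts and nonnegativity in terms of blocks\<close>

lemma count_list_replicate: "count_list (replicate a x) y = (if x = y then a else 0)"
  by (induction a) auto

lemma count_list_word:
  "count_list (word xs) U = ups xs"
  "count_list (word xs) D = downs xs"
  "count_list (word xs) D + count_list (word xs) H = length xs"
  by (induction xs rule: word.induct) (auto simp: count_list_replicate)

text \<open>Nonnegativity of a path started at height \<open>c\<close>. Only a down-step can violate
  it, so \<open>k\<close> does not enter.\<close>

fun nonneg_from :: "nat \<Rightarrow> step list \<Rightarrow> bool" where
  "nonneg_from c [] \<longleftrightarrow> True"
| "nonneg_from c (U # P) \<longleftrightarrow> nonneg_from (Suc c) P"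
| "nonneg_from c (D # P) \<longleftrightarrow> c \<ge> 1 \<and> nonneg_from (c - 1) P"
| "nonneg_from c (H # P) \<longleftrightarrow> nonneg_from c P"

lemma endpoint_Nil [simp]: "endpoint k [] = 0"
  by (simp add: endpoint_def)

lemma endpoint_Cons [simp]: "endpoint k (s # P) = step_vec k s + endpoint k P"
  by (simp add: endpoint_def)

lemma all_take_Cons:
  "(\<forall>l \<le> length (x # xs). Q (take l (x # xs))) \<longleftrightarrow> Q [] \<and> (\<forall>l \<le> length xs. Q (x # take l xs))"
proof (intro iffI conjI allI impI)
  fix l
  assume *: "Q [] \<and> (\<forall>l \<le> length xs. Q (x # take l xs))" "l \<le> length (x # xs)"
  then show "Q (take l (x # xs))"
    by (cases l) auto
next
  assume *: "\<forall>l \<le> length (x # xs). Q (take l (x # xs))"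
  then show "Q []"
    by (metis le0 take0)
  show "Q (x # take l xs)" if "l \<le> length xs" for l
    using *[rule_format, of "Suc l"] that by simp
qed

lemma nonneg_from_iff:
  "nonneg_from c P \<longleftrightarrow> (\<forall>l \<le> length P. 0 \<le> int c + snd (endpoint k (take l P)))"
proof (induction c P rule: nonneg_from.induct)
  case (1 c)
  then show ?case by simp
next
  case (2 c P)
  then show ?case
    unfolding all_take_Cons[where Q = "\<lambda>P. 0 \<le> int c + snd (endpoint k P)"] by (simp add: algebra_simps)
next
  case (3 c P)
  \<comment> \<open>The prefix consisting of \<open>D\<close> alone forces \<open>c \<ge> 1\<close>,
    so the truncated \<open>c - 1\<close> is a true difference.\<close>
  have "(\<forall>l \<le> length P. 0 \<le> int c + snd (endpoint k (D # take l P))) \<Longrightarrow> c \<ge> 1"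
    by (drule spec[of _ 0]) simp
  then show ?case
    unfolding all_take_Cons[where Q = "\<lambda>P. 0 \<le> int c + snd (endpoint k P)"] using 3 by (cases "c \<ge> 1") (auto simp: algebra_simps of_nat_diff)
next
  case (4 c P)
  then show ?case
    unfolding all_take_Cons[where Q = "\<lambda>P. 0 \<le> int c + snd (endpoint k P)"] by simp
qed

lemma nonneg_from_replicate: "nonneg_from c (replicate a U @ P) \<longleftrightarrow> nonneg_from (c + a) P"
  by (induction a arbitrary: c) simp_all

text \<open>The hypothesis ends the path on the axis, so the height after the first step is
  \<open>downs xs - (a + ups xs)\<close> for the remaining blocks \<open>xs\<close>. For a
  down-step, \<open>c \<ge> 1\<close> is the domination inequality; for a horizontal step the
  inequality is automatic.\<close>

lemma nonneg_from_word:
  "c + ups xs = downs xs \<Longrightarrow> nonneg_from c (word xs) \<longleftrightarrow> dominated xs"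
proof (induction xs arbitrary: c rule: word.induct)
  case 1
  then show ?case by simp
next
  case (2 b a xs)
  show ?case
  proof (cases b)
    case True
    with 2 show ?thesis
      by (cases "c \<ge> 1") (auto simp: nonneg_from_replicate)
  next
    case False
    with 2 show ?thesis
      by (auto simp: nonneg_from_replicate)
  qed
qed

lemma endpoint_eq:
  "endpoint k P = (int (count_list P U + count_list P D + k * count_list P H),
     int (count_list P U) - int (count_list P D))"
proof (induction P)
  case (Cons s P)
  then show ?case by (cases s) (simp_all add: algebra_simps)
qed (simp add: zero_prod_def)

text \<open>Ending at height 0 forces equally many up- and down-steps, and then the abscissa is
  automatic.\<close>

lemma mem_kpaths_iff:
  "P \<in> kpaths (2 * m + k * j) k m j \<longleftrightarrow>
     count_list P U = m \<and> count_list P D = m \<and> count_list P H = j \<and> nonneg_from 0 P"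
  by (auto simp: kpaths_def is_kpath_def nonneg_from_iff[of 0 P k] endpoint_eq[of k P])

section \<open>Correspondence between paths and block lists\<close>

definition block_lists :: "nat \<Rightarrow> nat \<Rightarrow> nat \<Rightarrow> (bool \<times> nat) list set" where
  "block_lists N m p = {xs. length xs = N \<and> downs xs = m \<and> ups xs = p \<and> dominated xs}"

lemma finite_block_lists: "finite (block_lists N m p)"
proof (rule finite_subset)
  show "block_lists N m p \<subseteq> {xs. set xs \<subseteq> UNIV \<times> {..p} \<and> length xs = N}"
    by (auto simp: block_lists_def ups_def intro!: member_le_sum_list)
       (metis imageI member_le_sum_list set_map snd_conv)
qed (simp add: finite_lists_length_eq)

text \<open>The up-steps outside the blocks form the leading run; its length \<open>m - p\<close> is
  the starting height that \<open>nonneg_from_word\<close> requires.\<close>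

lemma path_of_blocks_mem:
  assumes "xs \<in> block_lists (m + j) m p" "p \<le> m"
  shows "replicate (m - p) U @ word xs \<in> kpaths (2 * m + k * j) k m j"
  using assms count_list_word[of xs] nonneg_from_word[of "m - p" xs]
  by (auto simp: mem_kpaths_iff block_lists_def count_list_replicate nonneg_from_replicate)

lemma blocks_of_path_mem:
  assumes "P \<in> kpaths (2 * m + k * j) k m j"
  shows "snd (blocks P) \<in> block_lists (m + j) m (ups (snd (blocks P)))"
    and "fst (blocks P) + ups (snd (blocks P)) = m"
proof -
  obtain b xs where bl: "blocks P = (b, xs)"
    by fastforce
  then have P: "P = replicate b U @ word xs"
    using word_blocks[of P] by simp
  from assms have cnt: "b + ups xs = m" "downs xs = m" "length xs = m + j"
    and nn: "nonneg_from b (word xs)"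
    using count_list_word[of xs]
    by (auto simp: mem_kpaths_iff P count_list_replicate nonneg_from_replicate)
  then show "snd (blocks P) \<in> block_lists (m + j) m (ups (snd (blocks P)))"
    and "fst (blocks P) + ups (snd (blocks P)) = m"
    using nonneg_from_word[of b xs] by (simp_all add: bl block_lists_def)
qed

section \<open>The weight of an encoded path\<close>

text \<open>What \<open>beta\<close> becomes once the first non-up step is cut off: a segment may
  now start at position 0, since its left neighbour was the removed step.\<close>

definition nonfinal_segments :: "nat \<Rightarrow> step list \<Rightarrow> nat" where
  "nonfinal_segments i P = card {c. u_segment P c i \<and> c + i < length P}"

text \<open>The left neighbour of an internal segment is not an up-step, so it is \<open>s\<close>
  or lies in \<open>R\<close>; positions shift by \<open>Suc b\<close>.\<close>

lemma internal_u_segment_append_iff: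
  assumes "s \<noteq> U"
  shows "internal_u_segment (replicate b U @ s # R) c i \<longleftrightarrow>
    (\<exists>c'. c = Suc b + c' \<and> u_segment R c' i \<and> c' + i < length R)"
proof -
  let ?P = "replicate b U @ s # R"
  have low: "?P ! l = U" if "l < b" for l
    using that by (simp add: nth_append)
  have mid: "?P ! b = s"
    by (simp add: nth_append)
  have high: "?P ! (Suc b + l) = R ! l" for l
    by (simp add: nth_append)
  show ?thesis
  proof
    assume int: "internal_u_segment ?P c i"
    then have "0 < c" "?P ! (c - 1) \<noteq> U"
      by (auto simp: internal_u_segment_def u_segment_def)
    then have "b \<le> c - 1"
      using low by (metis not_le)
    then obtain c' where c: "c = Suc b + c'"
      using \<open>0 < c\<close> by (metis Suc_diff_1 Suc_le_mono le_iff_add)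
    have "R ! l = U" if "c' \<le> l" "l < c' + i" for l
    proof -
      have "?P ! (Suc b + l) = U"
        using int that unfolding internal_u_segment_def u_segment_def c by simp
      then show ?thesis
        using high by simp
    qed
    moreover have "R ! (c' - 1) \<noteq> U" if "0 < c'"
      using int high[of "c' - 1"] that unfolding internal_u_segment_def u_segment_def c
      by (cases c') auto
    moreover have "R ! (c' + i) \<noteq> U" "c' + i < length R" "1 \<le> i"
      using int high[of "c' + i"] unfolding internal_u_segment_def u_segment_def c
      by (auto simp: add.assoc)
    ultimately show "\<exists>c'. c = Suc b + c' \<and> u_segment R c' i \<and> c' + i < length R"
      using c unfolding u_segment_def by auto
  next
    assume "\<exists>c'. c = Suc b + c' \<and> u_segment R c' i \<and> c' + i < length R"
    then obtain c' where c: "c = Suc b + c'" and u: "u_segment R c' i" and len: "c' + i < length R"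
      by blast
    have "?P ! l = U" if "c \<le> l" "l < c + i" for l
    proof -
      define l' where "l' = l - Suc b"
      with that(1) c have l': "l = Suc b + l'"
        by simp
      with that c have "R ! l' = U"
        using u by (simp add: u_segment_def)
      then show ?thesis
        using high l' by simp
    qed
    moreover have "?P ! (c - 1) \<noteq> U"
    proof (cases c')
      case 0
      then show ?thesis using mid c assms by simp
    next
      case (Suc d)
      then show ?thesis using high[of d] u c by (simp add: u_segment_def)
    qed
    moreover have "?P ! (c + i) \<noteq> U"
      using high[of "c' + i"] u len c by (simp add: u_segment_def add.assoc)
    ultimately show "internal_u_segment ?P c i"
      using u len c by (simp add: internal_u_segment_def u_segment_def)
  qed
qed

lemma beta_append:
  assumes "s \<noteq> U"
  shows "beta i (replicate b U @ s # R) = nonfinal_segments i R"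
proof -
  have "{c. internal_u_segment (replicate b U @ s # R) c i}
      = (\<lambda>c'. Suc b + c') ` {c'. u_segment R c' i \<and> c' + i < length R}"
    using internal_u_segment_append_iff[OF assms] by auto
  then show ?thesis
    by (simp add: beta_def nonfinal_segments_def card_image inj_on_def)
qed

lemma u_segment_start_iff:
  assumes "s \<noteq> U"
  shows "u_segment (replicate a U @ s # R) 0 i \<and> i < length (replicate a U @ s # R)
    \<longleftrightarrow> i = a \<and> 1 \<le> a"
proof
  assume *: "u_segment (replicate a U @ s # R) 0 i \<and> i < length (replicate a U @ s # R)"
  \<comment> \<open>A longer segment would contain \<open>s\<close>; a shorter one would not be
    maximal.\<close>
  then have "\<not> a < i" and "\<not> i < a"
    using assms by (auto simp: u_segment_def nth_append)
  with * show "i = a \<and> 1 \<le> a"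
    by (auto simp: u_segment_def)
qed (use assms in \<open>auto simp: u_segment_def nth_append\<close>)

text \<open>A segment counted here either starts at 0, and is then the nonempty leading run, or is
  internal.\<close>

lemma nonfinal_segments_append:
  assumes "s \<noteq> U"
  shows "nonfinal_segments i (replicate a U @ s # R) =
    of_bool (i = a \<and> 1 \<le> a) + nonfinal_segments i R"
proof -
  let ?P = "replicate a U @ s # R"
  let ?I = "{c. internal_u_segment ?P c i}"
  have "{c. u_segment ?P c i \<and> c + i < length ?P} =
      {c. c = 0 \<and> u_segment ?P 0 i \<and> i < length ?P} \<union> ?I"
    unfolding internal_u_segment_def by auto
  also have "{c. c = 0 \<and> u_segment ?P 0 i \<and> i < length ?P} =
      (if i = a \<and> 1 \<le> a then {0} else {})"
    using u_segment_start_iff[OF assms, of a R i] by auto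
  finally have "nonfinal_segments i ?P = card ((if i = a \<and> 1 \<le> a then {0} else {}) \<union> ?I)"
    by (simp only: nonfinal_segments_def)
  moreover have "finite ?I"
    by (rule finite_subset[of _ "{..length ?P}"]) (auto simp: internal_u_segment_def)
  moreover have "0 \<notin> ?I"
    by (simp add: internal_u_segment_def)
  ultimately have "nonfinal_segments i ?P = of_bool (i = a \<and> 1 \<le> a) + beta i ?P"
    by (auto simp: beta_def)
  then show ?thesis
    by (simp add: beta_append[OF assms])
qed

lemma nonfinal_segments_Nil: "nonfinal_segments i [] = 0"
  by (simp add: nonfinal_segments_def)

definition block_weight :: "(bool \<times> nat) list \<Rightarrow> qpoly" where
  "block_weight xs = prod_list (map (seg_weight \<circ> snd) xs)"

lemma prod_Var_of_bool:
  "a \<le> M \<Longrightarrow> (\<Prod>i = 1..M. Var i ^ of_bool (i = a \<and> 1 \<le> a)) = seg_weight a"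
proof (cases "a = 0")
  case False
  assume "a \<le> M"
  have "(\<Prod>i = 1..M. Var i ^ of_bool (i = a \<and> 1 \<le> a)) = (\<Prod>i = 1..M. if i = a then Var i else 1)"
    using False by (intro prod.cong) auto
  also have "\<dots> = Var a"
    using False \<open>a \<le> M\<close> by simp
  finally show ?thesis
    using False by (simp add: seg_weight_def)
qed (simp add: seg_weight_def)

text \<open>Domination forces the last block to contain no up-steps, so no final segment is missed.\<close>

lemma prod_nonfinal_segments_word:
  assumes "dominated ((b, a) # xs)" "a + length (word xs) \<le> M"
  shows "(\<Prod>i = 1..M. Var i ^ nonfinal_segments i (replicate a U @ word xs)) =
    block_weight ((b, a) # xs)"
  using assms
proof (induction xs arbitrary: a b)
  case Nil
  then show ?case
    by (simp add: nonfinal_segments_Nil block_weight_def seg_weight_def)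
next
  case (Cons x xs)
  obtain b' a' where x: "x = (b', a')"
    by fastforce
  define s where "s = (if b' then D else H)"
  have "s \<noteq> U"
    by (simp add: s_def)
  have "word (x # xs) = s # replicate a' U @ word xs"
    by (simp add: x s_def)
  then have "(\<Prod>i = 1..M. Var i ^ nonfinal_segments i (replicate a U @ word (x # xs)))
      = (\<Prod>i = 1..M. Var i ^ of_bool (i = a \<and> 1 \<le> a))
        * (\<Prod>i = 1..M. Var i ^ nonfinal_segments i (replicate a' U @ word xs))"
    by (simp only: nonfinal_segments_append[OF \<open>s \<noteq> U\<close>] power_add prod.distrib)
  also have "\<dots> = seg_weight a * block_weight ((b', a') # xs)"
    using Cons.prems Cons.IH[where a=a' and b=b'] x by (subst prod_Var_of_bool) auto
  finally show ?case
    by (simp add: block_weight_def x)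
qed

text \<open>The leading run is never internal, so only segments after the first non-up step count.
  The product runs up to the length of the whole path, whence the free bound \<open>M\<close> in the
  preceding lemma.\<close>

lemma path_weight_word:
  assumes "dominated xs" "xs \<noteq> []"
  shows "path_weight (replicate c U @ word xs) = block_weight xs"
proof -
  obtain b a ys where xs: "xs = (b, a) # ys"
    using assms(2) by (metis neq_Nil_conv surj_pair)
  define s where "s = (if b then D else H)"
  have "s \<noteq> U"
    by (simp add: s_def)
  have w: "word xs = s # replicate a U @ word ys"
    by (simp add: xs s_def)
  have "path_weight (replicate c U @ word xs) = (\<Prod>i = 1..length (replicate c U @ word xs).
      Var i ^ nonfinal_segments i (replicate a U @ word ys))"
    by (simp only: path_weight_def w beta_append[OF \<open>s \<noteq> U\<close>])
  also have "\<dots> = block_weight xs"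
    unfolding xs by (rule prod_nonfinal_segments_word) (use assms xs in auto)
  finally show ?thesis .
qed

section \<open>Recursion on the first block\<close>

definition block_sum :: "nat \<Rightarrow> nat \<Rightarrow> nat \<Rightarrow> qpoly" where
  "block_sum N m p = (\<Sum>xs \<in> block_lists N m p. block_weight xs)"

text \<open>Paths are grouped by the number \<open>p\<close> of up-steps inside blocks. Since
  \<open>m \<ge> 1\<close>, there is at least one block.\<close>

lemma sum_kpaths_eq_block_sum:
  assumes "m \<ge> 1"
  shows "(\<Sum>P \<in> kpaths (2 * m + k * j) k m j. path_weight P) = (\<Sum>p = 0..m. block_sum (m + j) m p)"
proof -
  let ?n = "2 * m + k * j"
  have "(\<Sum>p = 0..m. block_sum (m + j) m p)
      = (\<Sum>(p, xs) \<in> Sigma {0..m} (block_lists (m + j) m). block_weight xs)"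
    unfolding block_sum_def by (rule sum.Sigma) (simp_all add: finite_block_lists)
  also have "\<dots> = (\<Sum>P \<in> kpaths ?n k m j. path_weight P)"
  proof (rule sum.reindex_bij_witness[where j = "\<lambda>(p, xs). replicate (m - p) U @ word xs"
        and i = "\<lambda>P. (ups (snd (blocks P)), snd (blocks P))"], goal_cases)
    case (1 x)
    then show ?case
      by (auto simp: blocks_replicate blocks_word block_lists_def)
  next
    case (2 x)
    then show ?case
      by (auto simp: path_of_blocks_mem)
  next
    case (3 P)
    then show ?case
      using blocks_of_path_mem(2)[OF 3] word_blocks[of P]
      by (simp only: prod.case) (metis add_diff_cancel_right')
  next
    case (4 P)
    then show ?case
      using blocks_of_path_mem[OF 4] by auto
  next
    case (5 x)
    then show ?case
      using assms by (auto simp: block_lists_def intro!: path_weight_word)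
  qed
  finally show ?thesis ..
qed

text \<open>The domination inequality of the first block is exactly \<open>p \<le> m\<close>, so its
  run length \<open>a\<close> ranges freely over \<open>0..p\<close>.\<close>

lemma sum_block_lists_hd:
  assumes "p \<le> m"
  shows "(\<Sum>xs \<in> {xs \<in> block_lists (Suc N) (of_bool b + m) p. fst (hd xs) = b}. block_weight xs)
    = (\<Sum>a = 0..p. seg_weight a * block_sum N m (p - a))"
proof -
  have "(\<Sum>a = 0..p. seg_weight a * block_sum N m (p - a))
      = (\<Sum>(a, ys) \<in> Sigma {0..p} (\<lambda>a. block_lists N m (p - a)). seg_weight a * block_weight ys)"
    unfolding block_sum_def sum_distrib_left by (rule sum.Sigma) (simp_all add: finite_block_lists)
  also have "\<dots> = (\<Sum>xs \<in> {xs \<in> block_lists (Suc N) (of_bool b + m) p. fst (hd xs) = b}. block_weight xs)"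
  proof (rule sum.reindex_bij_witness[where j = "\<lambda>(a, ys). (b, a) # ys"
        and i = "\<lambda>xs. (snd (hd xs), tl xs)"], goal_cases)
    case (3 xs)
    then show ?case
      by (cases xs) (auto simp: block_lists_def)
  next
    case (4 xs)
    then show ?case
      by (cases xs) (auto simp: block_lists_def)
  qed (use assms in \<open>auto simp: block_lists_def block_weight_def\<close>)
  finally show ?thesis ..
qed

text \<open>The two terms are the lists starting with a down- and with a horizontal step. The former
  leaves \<open>m - 1\<close> down-steps to dominate all \<open>p\<close> up-steps, hence the
  condition \<open>p < m\<close>.\<close>

lemma block_sum_Suc:
  assumes "p \<le> m"
  shows "block_sum (Suc N) m p =
    (if p < m then \<Sum>a = 0..p. seg_weight a * block_sum N (m - 1) (p - a) else 0)
    + (\<Sum>a = 0..p. seg_weight a * block_sum N m (p - a))"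
proof -
  let ?V = "\<lambda>b. {xs \<in> block_lists (Suc N) m p. fst (hd xs) = b}"
  have "block_sum (Suc N) m p = sum block_weight (?V True \<union> ?V False)"
    unfolding block_sum_def by (rule sum.cong) auto
  also have "\<dots> = sum block_weight (?V True) + sum block_weight (?V False)"
    by (rule sum.union_disjoint) (auto simp: finite_block_lists)
  finally have "block_sum (Suc N) m p = sum block_weight (?V True) + sum block_weight (?V False)" .
  moreover have "sum block_weight (?V False) = (\<Sum>a = 0..p. seg_weight a * block_sum N m (p - a))"
    using sum_block_lists_hd[OF assms, of N False] by simp
  moreover have "sum block_weight (?V True) =
      (if p < m then \<Sum>a = 0..p. seg_weight a * block_sum N (m - 1) (p - a) else 0)"
  proof (cases "p < m")
    case True
    then show ?thesis
      using sum_block_lists_hd[of p "m - 1" N True] by simp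
  next
    case False
    have "?V True = {}"
    proof (rule equals0I)
      fix xs
      assume "xs \<in> ?V True"
      then show False
        using False by (cases xs) (auto simp: block_lists_def)
    qed
    with False show ?thesis
      by (simp only: sum.empty if_False)
  qed
  ultimately show ?thesis
    by simp
qed

text \<open>Affine in \<open>p\<close>, the shape that \<open>seg_gf_linear_convolution\<close>
  preserves. For \<open>N = 0\<close> the division yields 0 and only the indicator of
  \<open>m = 0\<close> remains.\<close>

definition block_coeff :: "nat \<Rightarrow> nat \<Rightarrow> nat \<Rightarrow> rat" where
  "block_coeff N m p =
     of_nat (N choose m) - of_nat p * of_nat (Suc N choose Suc m) / of_nat N"

text \<open>Both branches of the recursion keep the affine shape, and Pascal's rule adds up both
  pairs of binomials. At \<open>p = m\<close> the down-branch is missing, which agrees because its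
  coefficient would be 0.\<close>

lemma block_sum_eq:
  "p \<le> m \<Longrightarrow> block_sum N m p = Cst (block_coeff N m p) * fps_nth (seg_gf ^ N) p"
proof (induction N arbitrary: m p)
  case 0
  have "block_lists 0 m p = (if m = 0 \<and> p = 0 then {[]} else {})"
    by (auto simp: block_lists_def)
  with 0 show ?case
    by (auto simp: block_sum_def block_weight_def block_coeff_def gr0_conv_Suc)
next
  case (Suc N)
  have conv: "(\<Sum>a = 0..p. seg_weight a * block_sum N m' (p - a))
      = Cst (of_nat (N choose m') - of_nat p * of_nat (Suc N choose Suc m') / of_nat (Suc N))
        * fps_nth (seg_gf ^ Suc N) p" if "p \<le> m'" for m'
  proof -
    have "(\<Sum>a = 0..p. seg_weight a * block_sum N m' (p - a))
      = (\<Sum>a = 0..p. seg_weight a * (Cst (of_nat (N choose m')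
          - of_nat (p - a) * of_nat (Suc N choose Suc m') / of_nat N) * fps_nth (seg_gf ^ N) (p - a)))"
      using that by (intro sum.cong) (simp_all add: Suc.IH block_coeff_def)
    also have "\<dots> = Cst (of_nat (N choose m') - of_nat p * of_nat (Suc N choose Suc m') / of_nat (Suc N))
        * fps_nth (seg_gf ^ Suc N) p"
      \<comment> \<open>The side condition for \<open>N = 0\<close>: either \<open>m' = 0\<close>
        and so \<open>p = 0\<close>, or \<open>Suc 0 choose Suc m'\<close> is 0.\<close>
      by (rule seg_gf_linear_convolution) (use that in \<open>cases m'; simp\<close>)
    finally show ?thesis .
  qed
  show ?case
  proof (cases "p < m")
    case True
    then obtain m' where m: "m = Suc m'"
      by (cases m) auto
    have "block_sum (Suc N) m p =
      (Cst (of_nat (N choose m') - of_nat p * of_nat (Suc N choose Suc m') / of_nat (Suc N))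
       + Cst (of_nat (N choose m) - of_nat p * of_nat (Suc N choose Suc m) / of_nat (Suc N)))
        * fps_nth (seg_gf ^ Suc N) p"
      using True conv[of m] conv[of m'] by (simp add: block_sum_Suc m distrib_right del: power_Suc)
    also have "Cst (of_nat (N choose m') - of_nat p * of_nat (Suc N choose Suc m') / of_nat (Suc N))
       + Cst (of_nat (N choose m) - of_nat p * of_nat (Suc N choose Suc m) / of_nat (Suc N))
       = Cst (block_coeff (Suc N) m p)"
      unfolding Cst_add[symmetric] block_coeff_def
      by (rule arg_cong[of _ _ Cst]) (simp add: m add_divide_distrib distrib_left)
    finally show ?thesis .
  next
    case False
    with Suc.prems have p: "p = m"
      by simp
    \<comment> \<open>Absorption identity turning the coefficient at \<open>p = m\<close> into that
      of the horizontal branch alone. For \<open>m > N\<close> both sides vanish.\<close>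
    have "of_nat (Suc N) * (of_nat (N choose m) :: rat) =
        (of_nat (Suc N) - of_nat m) * of_nat (Suc N choose m)"
    proof (cases "m \<le> N")
      case True
      have "Suc N * (N choose m) = (Suc N - m) * (Suc N choose m)"
        using binomial_absorb_comp[of "Suc N" m] by simp
      then have "of_nat (Suc N * (N choose m)) = (of_nat ((Suc N - m) * (Suc N choose m)) :: rat)"
        by (rule arg_cong)
      with True show ?thesis
        by (simp only: of_nat_mult of_nat_diff le_SucI)
    qed (cases "m = Suc N"; simp add: binomial_eq_0)
    then have "block_coeff (Suc N) m p =
        of_nat (N choose m) - of_nat p * of_nat (Suc N choose Suc m) / of_nat (Suc N)"
      unfolding block_coeff_def p binomial_Suc_Suc[of "Suc N" m]
      by (simp add: field_simps del: binomial_Suc_Suc)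
    then show ?thesis
      using False Suc.prems conv[of m] by (simp add: block_sum_Suc del: power_Suc)
  qed
qed

section \<open>Potential polynomials in terms of Bell polynomials\<close>

lemma finite_bell_indices: "finite (bell_indices p r)"
proof (rule finite_subset)
  show "bell_indices p r \<subseteq> {s. \<forall>i. (i \<in> {1..p} \<longrightarrow> s i \<in> {..r}) \<and> (i \<notin> {1..p} \<longrightarrow> s i = 0)}"
    by (auto simp: bell_indices_def intro!: member_le_sum)
qed (rule finite_set_of_finite_funs; simp)

text \<open>A product of divided powers y_i^(s_i) / s_i!, so that changing one exponent affects one
  factor only.\<close>

definition bell_monomial :: "(nat \<Rightarrow> qpoly) \<Rightarrow> nat \<Rightarrow> (nat \<Rightarrow> nat) \<Rightarrow> qpoly" where
  "bell_monomial y p s = (\<Prod>i = 1..p. Cst (1 / fact (s i)) * y i ^ s i)"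

lemma bell_eq:
  "bell p r x = Cst (fact p) * (\<Sum>s \<in> bell_indices p r. bell_monomial (\<lambda>i. Cst (1 / fact i) * x i) p s)"
proof -
  have "fact p / (\<Prod>i = 1..p. fact (s i)) = fact p * (\<Prod>i = 1..p. 1 / fact (s i) :: rat)" for s :: "nat \<Rightarrow> nat"
    by (simp add: prod_dividef)
  then show ?thesis
    unfolding bell_def bell_monomial_def sum_distrib_left prod.distrib
    by (intro sum.cong refl) (simp only: Cst_mult Cst_prod mult.assoc)
qed

text \<open>The divided power rule (e+1) y^(e+1) / (e+1)! = y * y^e / e!.\<close>

lemma bell_monomial_upd_Suc:
  assumes "i \<in> {1..p}"
  shows "of_nat (Suc (s i)) * bell_monomial y p (s(i := Suc (s i))) = y i * bell_monomial y p s"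
proof -
  let ?R = "\<Prod>l \<in> {1..p} - {i}. Cst (1 / fact (s l)) * y l ^ s l"
  have 1: "bell_monomial y p s = Cst (1 / fact (s i)) * y i ^ s i * ?R"
    unfolding bell_monomial_def using assms by (simp add: prod.remove[of _ i])
  have "bell_monomial y p (s(i := Suc (s i))) = Cst (1 / fact (Suc (s i))) * y i ^ Suc (s i) *
      (\<Prod>l \<in> {1..p} - {i}. Cst (1 / fact ((s(i := Suc (s i))) l)) * y l ^ (s(i := Suc (s i))) l)"
    unfolding bell_monomial_def using assms by (simp add: prod.remove[of _ i])
  also have "(\<Prod>l \<in> {1..p} - {i}. Cst (1 / fact ((s(i := Suc (s i))) l)) * y l ^ (s(i := Suc (s i))) l) = ?R"
    by (rule prod.cong) auto
  finally have 2: "bell_monomial y p (s(i := Suc (s i)))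
      = Cst (1 / fact (Suc (s i))) * y i ^ Suc (s i) * ?R" .
  have 3: "of_nat (Suc (s i)) * Cst (1 / fact (Suc (s i))) = Cst (1 / fact (s i))"
    unfolding Cst_of_nat[symmetric] Cst_mult[symmetric] by (simp add: field_simps del: of_nat_Suc)
  show ?thesis
    unfolding 1 2 3[symmetric] by (simp add: algebra_simps del: of_nat_Suc)
qed

lemma bell_monomial_extend:
  assumes "s \<in> bell_indices q r" "q \<le> p"
  shows "bell_monomial y q s = bell_monomial y p s"
  unfolding bell_monomial_def
  by (rule prod.mono_neutral_left) (use assms in \<open>auto simp: bell_indices_def\<close>)

lemma bell_indices_extend:
  assumes "q \<le> p" "s \<in> bell_indices q r"
  shows "(\<Sum>i = 1..p. s i) = r" "(\<Sum>i = 1..p. i * s i) = q"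
proof -
  have "(\<Sum>i = 1..p. s i) = (\<Sum>i = 1..q. s i)" "(\<Sum>i = 1..p. i * s i) = (\<Sum>i = 1..q. i * s i)"
    by (rule sum.mono_neutral_right; use assms in \<open>auto simp: bell_indices_def\<close>)+
  with assms show "(\<Sum>i = 1..p. s i) = r" "(\<Sum>i = 1..p. i * s i) = q"
    by (simp_all add: bell_indices_def)
qed

text \<open>Raising the exponent at \<open>i\<close> adds 1 to the number of parts and
  \<open>i\<close> to their total.\<close>

lemma bell_indices_upd_iff:
  assumes "i \<in> {1..p}"
  shows "s(i := Suc (s i)) \<in> bell_indices p (Suc r) \<longleftrightarrow> s \<in> bell_indices (p - i) r"
proof -
  have "(s(i := Suc (s i))) l = s l + (if l = i then 1 else 0)"
    and "l * (s(i := Suc (s i))) l = l * s l + (if l = i then i else 0)" for l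
    by simp_all
  then have upd: "(\<Sum>l = 1..p. (s(i := Suc (s i))) l) = Suc (\<Sum>l = 1..p. s l)"
    "(\<Sum>l = 1..p. l * (s(i := Suc (s i))) l) = (\<Sum>l = 1..p. l * s l) + i"
    using assms by (simp_all only: sum.distrib) simp_all
  show ?thesis
  proof
    assume *: "s(i := Suc (s i)) \<in> bell_indices p (Suc r)"
    then have s1: "(\<Sum>l = 1..p. s l) = r" and s2: "(\<Sum>l = 1..p. l * s l) = p - i"
      using upd by (auto simp: bell_indices_def)
    have supp: "s l = 0" if "l \<notin> {1..p}" for l
    proof -
      have "(s(i := Suc (s i))) l = 0"
        using * that unfolding bell_indices_def by blast
      with that assms show ?thesis
        by (auto split: if_splits)
    qed
    \<comment> \<open>A nonzero exponent at \<open>l\<close> contributes at least \<open>l\<close>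
      to the total \<open>p - i\<close>, so the support shrinks to
      \<open>{1..p - i}\<close>.\<close>
    have supp': "s l = 0" if "l \<notin> {1..p - i}" for l
    proof (rule ccontr)
      assume "s l \<noteq> 0"
      with supp[of l] have l: "l \<in> {1..p}"
        by metis
      have "l \<le> l * s l"
        using \<open>s l \<noteq> 0\<close> by simp
      also have "\<dots> \<le> (\<Sum>l = 1..p. l * s l)"
        using l by (intro member_le_sum[of l "{1..p}" "\<lambda>l. l * s l"]) auto
      finally have "l \<le> p - i"
        unfolding s2 .
      with that l show False by simp
    qed
    have "(\<Sum>l = 1..p. s l) = (\<Sum>l = 1..p - i. s l)" "(\<Sum>l = 1..p. l * s l) = (\<Sum>l = 1..p - i. l * s l)"
      by (rule sum.mono_neutral_right; use supp' in auto)+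
    with s1 s2 supp' show "s \<in> bell_indices (p - i) r"
      by (simp add: bell_indices_def)
  next
    assume *: "s \<in> bell_indices (p - i) r"
    then show "s(i := Suc (s i)) \<in> bell_indices p (Suc r)"
      using bell_indices_extend[OF _ *, of p] upd assms
      by (auto simp: bell_indices_def)
  qed
qed

text \<open>Write \<open>Suc r\<close> as the sum of the exponents of each monomial and split off
  one factor \<open>y i\<close> from each.\<close>

lemma bell_sum_Suc:
  "of_nat (Suc r) * (\<Sum>s \<in> bell_indices p (Suc r). bell_monomial y p s)
   = (\<Sum>i = 1..p. y i * (\<Sum>s \<in> bell_indices (p - i) r. bell_monomial y (p - i) s))"
proof -
  have "of_nat (Suc r) * (\<Sum>s \<in> bell_indices p (Suc r). bell_monomial y p s)
      = (\<Sum>s \<in> bell_indices p (Suc r). \<Sum>i = 1..p. of_nat (s i) * bell_monomial y p s)"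
    unfolding sum_distrib_left
  proof (rule sum.cong[OF refl])
    fix s
    assume "s \<in> bell_indices p (Suc r)"
    then have "Suc r = (\<Sum>i = 1..p. s i)"
      by (simp add: bell_indices_def)
    then show "of_nat (Suc r) * bell_monomial y p s
        = (\<Sum>i = 1..p. of_nat (s i) * bell_monomial y p s)"
      by (simp only: of_nat_sum sum_distrib_right)
  qed
  also have "\<dots> = (\<Sum>i = 1..p. \<Sum>s \<in> bell_indices p (Suc r). of_nat (s i) * bell_monomial y p s)"
    by (rule sum.swap)
  also have "\<dots> = (\<Sum>i = 1..p. y i * (\<Sum>s \<in> bell_indices (p - i) r. bell_monomial y (p - i) s))"
  proof (rule sum.cong[OF refl])
    fix i
    assume i: "i \<in> {1..p}"
    \<comment> \<open>Terms with \<open>s i = 0\<close> vanish; on the others, lowering the exponent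
      at \<open>i\<close> is a bijection.\<close>
    have "(\<Sum>s \<in> bell_indices p (Suc r). of_nat (s i) * bell_monomial y p s)
        = (\<Sum>s \<in> {s \<in> bell_indices p (Suc r). s i \<noteq> 0}. of_nat (s i) * bell_monomial y p s)"
      by (rule sum.mono_neutral_right) (auto simp: finite_bell_indices)
    also have "\<dots> = (\<Sum>s \<in> bell_indices (p - i) r. y i * bell_monomial y (p - i) s)"
    proof (rule sum.reindex_bij_witness[where i = "\<lambda>s. s(i := Suc (s i))"
          and j = "\<lambda>s. s(i := s i - 1)"], goal_cases)
      case (2 s)
      then show ?case
        using bell_indices_upd_iff[OF i, of "s(i := s i - 1)" r] by simp
    next
      case (4 s)
      then show ?case
        using bell_indices_upd_iff[OF i, of s r] by simp
    next
      case (5 s)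
      then have "s(i := s i - 1) \<in> bell_indices (p - i) r"
        using bell_indices_upd_iff[OF i, of "s(i := s i - 1)" r] by simp
      with 5 show ?case
        using bell_monomial_upd_Suc[OF i, of "s(i := s i - 1)" y]
        by (simp add: bell_monomial_extend[of _ "p - i" r p])
    qed auto
    finally show "(\<Sum>s \<in> bell_indices p (Suc r). of_nat (s i) * bell_monomial y p s)
        = y i * (\<Sum>s \<in> bell_indices (p - i) r. bell_monomial y (p - i) s)"
      by (simp add: sum_distrib_left)
  qed
  finally show ?thesis .
qed

text \<open>Without a constant term, multiplication by \<open>egf x - 1\<close> is the convolution
  in \<open>bell_sum_Suc\<close>; its factors \<open>Suc r\<close> accumulate to
  \<open>fact r\<close>.\<close>

lemma egf_minus_1_power:
  "fps_nth ((egf x - 1) ^ r) p = Cst (fact r / fact p) * bell p r x"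
proof -
  define y where "y = (\<lambda>i. Cst (1 / fact i) * x i)"
  have "fps_nth ((egf x - 1) ^ r) p = Cst (fact r) * (\<Sum>s \<in> bell_indices p r. bell_monomial y p s)"
  proof (induction r arbitrary: p)
    case 0
    have "bell_indices p 0 = (if p = 0 then {\<lambda>_. 0} else {})"
      by (auto simp: bell_indices_def fun_eq_iff)
    then show ?case
      by (simp add: bell_monomial_def)
  next
    case (Suc r)
    have nth: "fps_nth (egf x - 1) i = y i" if "i \<in> {1..p}" for i
      using that by (auto simp: egf_def y_def)
    have "fps_nth ((egf x - 1) ^ Suc r) p
        = (\<Sum>i = 0..p. fps_nth (egf x - 1) i * fps_nth ((egf x - 1) ^ r) (p - i))"
      by (simp add: fps_mult_nth)
    also have "\<dots> = (\<Sum>i = 1..p. fps_nth (egf x - 1) i * fps_nth ((egf x - 1) ^ r) (p - i))"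
      by (rule sum.mono_neutral_right) (auto simp: egf_def)
    also have "\<dots> = (\<Sum>i = 1..p. Cst (fact r) *
        (y i * (\<Sum>s \<in> bell_indices (p - i) r. bell_monomial y (p - i) s)))"
      by (intro sum.cong refl) (simp only: nth Suc.IH mult.left_commute)
    also have "\<dots> = Cst (fact r) *
        (of_nat (Suc r) * (\<Sum>s \<in> bell_indices p (Suc r). bell_monomial y p s))"
      unfolding bell_sum_Suc by (rule sum_distrib_left[symmetric])
    finally show ?case
      by (simp add: Cst_of_nat[symmetric] Cst_mult_assoc mult.commute del: of_nat_Suc)
  qed
  then show ?thesis
    by (simp add: bell_eq y_def Cst_mult_assoc)
qed

lemma potential_eq_sum_bell:
  "potential l p x = (\<Sum>r = 0..p. Cst (binom l (int r) * fact r) * bell p r x)"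
proof -
  let ?g = "egf x - 1"
  have "fps_nth (egf x ^ l) p = fps_nth ((?g + 1) ^ l) p"
    by simp
  also have "\<dots> = (\<Sum>r \<le> l. of_nat (l choose r) * fps_nth (?g ^ r) p)"
    by (subst binomial_ring) (simp add: fps_sum_nth fps_mult_of_nat_nth)
  \<comment> \<open>The range is enlarged to cover both \<open>l\<close> and \<open>p\<close>, then
    cut at \<open>p\<close>: binomials vanish for \<open>r > l\<close>, and powers of a series
    without constant term for \<open>r > p\<close>.\<close>
  also have "\<dots> = (\<Sum>r \<le> l + p. of_nat (l choose r) * fps_nth (?g ^ r) p)"
    by (rule sum.mono_neutral_left) auto
  also have "\<dots> = (\<Sum>r = 0..p. of_nat (l choose r) * fps_nth (?g ^ r) p)"
  proof (rule sum.mono_neutral_right)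
    have "fps_nth ?g 0 = 0"
      by (simp add: egf_def)
    then show "\<forall>r \<in> {..l + p} - {0..p}. of_nat (l choose r) * fps_nth (?g ^ r) p = 0"
      by (auto simp: startsby_zero_power_prefix)
  qed auto
  also have "Cst (fact p) * \<dots> = (\<Sum>r = 0..p. Cst (binom l (int r) * fact r) * bell p r x)"
    unfolding sum_distrib_left
    by (intro sum.cong refl)
       (simp add: egf_minus_1_power binom_def Cst_of_nat[symmetric] Cst_mult_assoc mult.commute
         Cst_mult[symmetric])
  finally show ?thesis
    by (simp add: potential_def)
qed

section \<open>The two forms of the coefficients\<close>

text \<open>The ratio of neighbouring binomials; at \<open>j = 0\<close> the convention for a
  negative lower index makes both sides 0.\<close>

lemma binom_pred:
  "(of_nat m + 1) * binom (m + j) (int j - 1) = of_nat j * binom (m + j) (int j)"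
proof (cases j)
  case (Suc i)
  have "Suc i * (Suc (m + i) choose Suc i) = Suc m * (Suc (m + i) choose i)"
    using binomial_absorption[of i "Suc (m + i)"] binomial_absorb_comp[of "Suc (m + i)" i] by simp
  then have "of_nat (Suc i * (Suc (m + i) choose Suc i)) = (of_nat (Suc m * (Suc (m + i) choose i)) :: rat)"
    by (rule arg_cong)
  then show ?thesis
    by (simp add: Suc binom_def nat_add_distrib algebra_simps del: binomial_Suc_Suc)
qed (simp add: binom_def)

text \<open>Absorption writes the second binomial as (m+j+1) / (m+1) times the first, which then
  factors out.\<close>

lemma block_coeff_eq_product:
  assumes "m \<ge> 1"
  shows "block_coeff (m + j) m p = binom (m + j) (int j) *
    (((of_nat m + 1) * (of_nat m - of_nat p) + of_nat j * (of_nat m - of_nat p + 1))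
     / ((of_nat m + 1) * of_nat (m + j)))"
proof -
  let ?c = "of_nat (m + j choose m) :: rat"
  have c: "binom (m + j) (int j) = ?c"
    by (simp add: binom_def binomial_symmetric[of m])
  have "Suc m * (Suc (m + j) choose Suc m) = Suc (m + j) * (m + j choose m)"
    using Suc_times_binomial_eq[of "m + j" m] by (simp add: mult.commute)
  then have "of_nat (Suc m * (Suc (m + j) choose Suc m)) = (of_nat (Suc (m + j) * (m + j choose m)) :: rat)"
    by (rule arg_cong)
  then have d: "of_nat (Suc (m + j) choose Suc m) = of_nat (Suc (m + j)) * ?c / of_nat (Suc m)"
    by (simp only: of_nat_mult) (simp add: field_simps del: binomial_Suc_Suc)
  have "of_nat m + of_nat j \<noteq> (0 :: rat)"
    using assms by (metis add_is_0 not_one_le_zero of_nat_add of_nat_eq_0_iff)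
  moreover have "1 + of_nat m \<noteq> (0 :: rat)"
    by (metis of_nat_Suc of_nat_eq_0_iff nat.distinct(1))
  ultimately show ?thesis
    unfolding block_coeff_def c d by (simp add: divide_simps) (simp add: algebra_simps)
qed

text \<open>Distribute the product form and trade j / (m+1) times the binomial for its lower
  neighbour by \<open>binom_pred\<close>.\<close>

lemma block_coeff_eq_sum:
  assumes "m \<ge> 1"
  shows "block_coeff (m + j) m p =
    (of_nat m - of_nat p) / of_nat (m + j) * binom (m + j) (int j)
      + (of_nat m - of_nat p + 1) / of_nat (m + j) * binom (m + j) (int j - 1)"
proof -
  have "of_nat m + of_nat j \<noteq> (0 :: rat)"
    using assms by (metis add_is_0 not_one_le_zero of_nat_add of_nat_eq_0_iff)
  moreover have m1: "of_nat m + 1 \<noteq> (0 :: rat)"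
    by (metis of_nat_Suc of_nat_eq_0_iff nat.distinct(1) add.commute)
  moreover have "binom (m + j) (int j - 1) = of_nat j * binom (m + j) (int j) / (of_nat m + 1)"
    using binom_pred[of m j] m1 by (simp add: field_simps)
  ultimately show ?thesis
    unfolding block_coeff_eq_product[OF assms] by (simp add: divide_simps) (simp add: algebra_simps)
qed

theorem theorem3p2:
  fixes k j m n :: nat
  assumes "m \<ge> 1" and "n = 2 * m + k * j"
  shows "(\<Sum>P \<in> kpaths n k m j. path_weight P) =
      (\<Sum>p = 0..m.
        Cst ((of_nat m - of_nat p) / of_nat (m + j) * binom (m + j) (int j)
             + (of_nat m - of_nat p + 1) / of_nat (m + j) * binom (m + j) (int j - 1))
        * (Cst (1 / fact p) * potential (m + j) p (\<lambda>i. Cst (fact i) * Var i)))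
    \<and> (\<Sum>p = 0..m.
        Cst ((of_nat m - of_nat p) / of_nat (m + j) * binom (m + j) (int j)
             + (of_nat m - of_nat p + 1) / of_nat (m + j) * binom (m + j) (int j - 1))
        * (Cst (1 / fact p) * potential (m + j) p (\<lambda>i. Cst (fact i) * Var i))) =
      Cst (binom (m + j) (int j)) *
      (\<Sum>p = 0..m.
        Cst (((of_nat m + 1) * (of_nat m - of_nat p) + of_nat j * (of_nat m - of_nat p + 1))
             / ((of_nat m + 1) * of_nat (m + j)))
        * (\<Sum>r = 0..p. Cst (binom (m + j) (int r) * (fact r / fact p))
             * bell p r (\<lambda>i. Cst (fact i) * Var i)))"
proof -
  let ?x = "\<lambda>i. Cst (fact i) * Var i"
  let ?c = "\<lambda>p. (of_nat m - of_nat p) / of_nat (m + j) * binom (m + j) (int j)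
      + (of_nat m - of_nat p + 1) / of_nat (m + j) * binom (m + j) (int j - 1) :: rat"
  \<comment> \<open>All factorials cancel, leaving an ordinary coefficient of a power of
    \<open>seg_gf\<close>.\<close>
  have pot: "Cst (1 / fact p) * potential (m + j) p ?x = fps_nth (seg_gf ^ (m + j)) p" for p
    by (simp add: potential_def seg_gf_eq_egf Cst_mult_assoc)
  have "(\<Sum>P \<in> kpaths n k m j. path_weight P) = (\<Sum>p = 0..m. block_sum (m + j) m p)"
    unfolding assms(2) by (rule sum_kpaths_eq_block_sum[OF assms(1)])
  also have "\<dots> = (\<Sum>p = 0..m. Cst (?c p) * (Cst (1 / fact p) * potential (m + j) p ?x))"
    by (intro sum.cong refl) (simp only: block_sum_eq block_coeff_eq_sum[OF assms(1)] pot atLeastAtMost_iff)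
  finally have first: "(\<Sum>P \<in> kpaths n k m j. path_weight P)
      = (\<Sum>p = 0..m. Cst (?c p) * (Cst (1 / fact p) * potential (m + j) p ?x))" .
  have bell: "Cst (1 / fact p) * potential (m + j) p ?x
      = (\<Sum>r = 0..p. Cst (binom (m + j) (int r) * (fact r / fact p)) * bell p r ?x)" for p
    unfolding potential_eq_sum_bell sum_distrib_left
    by (intro sum.cong refl) (simp add: Cst_mult_assoc)
  show ?thesis
    unfolding first sum_distrib_left[of "Cst (binom (m + j) (int j))"]
    by (intro conjI refl sum.cong)
       (simp only: bell Cst_mult_assoc block_coeff_eq_sum[OF assms(1), symmetric]
          block_coeff_eq_product[OF assms(1)])
qed

end
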